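(* Let $s,t\ge 2$ be coprime integers. If $\lambda$ is a partition that is $s$-regular and $t$-distinct, then $\phi_s(\phi_t(\lambda))$ is $t$-regular and $s$-distinct.
   Context: A partition is $m$-regular if none of its parts is divisible by $m$, and $m$-distinct if no part appears $m$ or more times. For an integer $m\ge 2$, Glaisher's map $\phi_m$ on partitions is defined as follows. Every positive integer is uniquely $jm^k$ with $m\nmid j$, $k\ge 0$. For a partition $\lambda$, if the part $jm^k$ appears in $\lambda$ with multiplicity whose base-$m$ expansion is $\sum_{\ell\ge 0} a_{k,\ell}m^\ell$ ($0\le a_{k,\ell}<m$), then $\phi_m(\lambda)$ is the partition in which, for each $j$ with $m\nmid j$ and each $\ell\ge0$, the part $jm^\ell$ appears $\sum_{k\ge 0} a_{k,\ell}m^k$ times. (Thus $\phi_m$ preserves the sum of parts.) *)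

theory Defs
  imports "HOL-Library.Multiset" "HOL-Computational_Algebra.Primes"
begin

text \<open>A partition is a finite multiset of positive integers.\<close>

definition partition_mset :: "nat multiset \<Rightarrow> bool" where
  "partition_mset \<mu> \<longleftrightarrow> (\<forall>p\<in>#\<mu>. 0 < p)"

definition regular_partition :: "nat \<Rightarrow> nat multiset \<Rightarrow> bool" where
  "regular_partition m \<mu> \<longleftrightarrow> (\<forall>p\<in>#\<mu>. \<not> m dvd p)"

definition distinct_partition :: "nat \<Rightarrow> nat multiset \<Rightarrow> bool" where
  "distinct_partition m \<mu> \<longleftrightarrow> (\<forall>p. count \<mu> p < m)"

text \<open>The coefficient of \<open>m ^ l\<close> in the base-\<open>m\<close> expansion of \<open>n\<close>.\<close>

definition base_digit :: "nat \<Rightarrow> nat \<Rightarrow> nat \<Rightarrow> nat" where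
  "base_digit m n l = n div m ^ l mod m"

text \<open>
  The multiplicity of \<open>j * m ^ l\<close> in the image, for \<open>\<not> m dvd j\<close>. Only those \<open>k\<close> for which
  \<open>j * m ^ k\<close> is a part of \<open>\<mu>\<close> contribute to the sum over all \<open>k\<close>.
\<close>

definition glaisher_count :: "nat \<Rightarrow> nat multiset \<Rightarrow> nat \<Rightarrow> nat \<Rightarrow> nat" where
  "glaisher_count m \<mu> j l =
     (\<Sum>k | j * m ^ k \<in># \<mu>. base_digit m (count \<mu> (j * m ^ k)) l * m ^ k)"

text \<open>
  A part \<open>p > 0\<close> is written as \<open>j * m ^ l\<close> with \<open>l = multiplicity m p\<close>, the largest exponent
  such that \<open>m ^ l dvd p\<close>; here \<open>m\<close> need not be prime. The count function below has finite
  support for \<open>m \<ge> 2\<close>, see the lemma \<open>count_glaisher\<close>.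
\<close>

definition glaisher :: "nat \<Rightarrow> nat multiset \<Rightarrow> nat multiset" where
  "glaisher m \<mu> = Abs_multiset (\<lambda>p. if p = 0 then 0
     else glaisher_count m \<mu> (p div m ^ multiplicity m p) (multiplicity m p))"

lemma finite_glaisher_exponents:
  fixes m j :: nat
  assumes "m \<ge> 2" and "j > 0"
  shows "finite {k. j * m ^ k \<in># \<mu>}"
proof (rule finite_imageD)
  show "finite ((\<lambda>k. j * m ^ k) ` {k. j * m ^ k \<in># \<mu>})"
    by (rule finite_subset[of _ "set_mset \<mu>"]) auto
  show "inj_on (\<lambda>k. j * m ^ k) {k. j * m ^ k \<in># \<mu>}"
    using assms by (auto simp: inj_on_def power_inject_exp)
qed

lemma finite_glaisher_support:
  fixes m :: nat
  assumes m: "m \<ge> 2"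
  shows "finite {p. 0 < (if p = 0 then 0
     else glaisher_count m \<mu> (p div m ^ multiplicity m p) (multiplicity m p))}"
    (is "finite ?S")
proof (rule finite_subset)
  let ?T = "\<Union>q\<in>set_mset \<mu>. (\<lambda>(k, l). q div m ^ k * m ^ l) ` ({..q} \<times> {..count \<mu> q})"
  show "finite ?T" by auto
  show "?S \<subseteq> ?T"
  proof
    fix p assume "p \<in> ?S"
    define l where "l = multiplicity m p"
    define j where "j = p div m ^ l"
    have p: "p > 0" and pos: "glaisher_count m \<mu> j l > 0"
      using \<open>p \<in> ?S\<close> by (auto simp: l_def j_def split: if_splits)
    have pj: "p = j * m ^ l" by (simp add: j_def l_def multiplicity_dvd)
    hence j: "j > 0" using p by (cases "j = 0") auto
    have "glaisher_count m \<mu> j l \<noteq> 0" using pos by simp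
    then obtain k where k: "j * m ^ k \<in># \<mu>"
        and d: "base_digit m (count \<mu> (j * m ^ k)) l * m ^ k \<noteq> 0"
      unfolding glaisher_count_def by (metis (mono_tags, lifting) mem_Collect_eq sum.neutral)
    let ?q = "j * m ^ k"
    have "\<not> count \<mu> ?q < m ^ l" using d by (auto simp: base_digit_def)
    moreover have pw: "n < m ^ n" for n
      using m power_gt_expt[of m n] by simp
    ultimately have "l \<le> count \<mu> ?q" using pw[of l] by linarith
    moreover have "k \<le> ?q"
    proof -
      have "k \<le> m ^ k" using pw[of k] by simp
      also have "\<dots> \<le> ?q" using j by simp
      finally show ?thesis .
    qed
    moreover have "p = ?q div m ^ k * m ^ l" using m pj by simp
    ultimately show "p \<in> ?T" using k
      by (intro UN_I[of ?q] image_eqI[of _ _ "(k, l)"]) simp_all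
  qed
qed

lemma count_glaisher:
  fixes m :: nat
  assumes m: "m \<ge> 2" and j: "\<not> m dvd j"
  shows "count (glaisher m \<mu>) (j * m ^ l) = glaisher_count m \<mu> j l"
proof -
  have "multiplicity m (j * m ^ l) = l"
    using m j by (intro multiplicity_eqI) (auto simp: mult.commute)
  moreover have "j > 0" using j by (cases "j = 0") auto
  ultimately show ?thesis
    using m finite_glaisher_support[OF m, of \<mu>]
    unfolding glaisher_def by (subst count_Abs_multiset) auto
qed

lemma partition_mset_glaisher:
  assumes "m \<ge> 2"
  shows "partition_mset (glaisher m \<mu>)"
proof -
  have "count (glaisher m \<mu>) 0 = 0"
    using finite_glaisher_support[OF assms, of \<mu>]
    unfolding glaisher_def by (subst count_Abs_multiset) auto
  thus ?thesis unfolding partition_mset_def by (metis not_in_iff gr0I)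
qed

end

theory Submission
  imports Defs
begin

text \<open>
  If \<open>\<mu>\<close> is \<open>m\<close>-distinct, all its multiplicities are single base-\<open>m\<close> digits, so only
  \<open>l = 0\<close> contributes and the image is \<open>m\<close>-regular. Dually, if \<open>\<mu>\<close> is \<open>m\<close>-regular, only
  \<open>k = 0\<close> contributes, so the multiplicities of the image are single digits and the image is
  \<open>m\<close>-distinct. Since \<open>\<phi>\<^sub>m\<close> only moves powers of \<open>m\<close> between parts, it preserves
  \<open>a\<close>-regularity for every \<open>a\<close> coprime to \<open>m\<close>. Hence \<open>\<phi>\<^sub>t(\<mu>)\<close> is both \<open>s\<close>-regular and
  \<open>t\<close>-regular; applying \<open>\<phi>\<^sub>s\<close> then keeps \<open>t\<close>-regularity and turns \<open>s\<close>-regularity into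
  \<open>s\<close>-distinctness.
\<close>

lemma nat_power_decompose:
  fixes m p :: nat
  assumes "m \<ge> 2" and "p > 0"
  obtains j l where "p = j * m ^ l" and "\<not> m dvd j"
proof -
  have "p \<noteq> 0" and "\<not> is_unit m" using assms by auto
  then obtain j where j: "p = m ^ multiplicity m p * j" "\<not> m dvd j"
    by (rule multiplicity_decompose')
  show ?thesis by (rule that[OF _ j(2)]) (subst mult.commute, rule j(1))
qed

text \<open>A positive multiplicity in the image is a nonzero sum; any nonzero summand traces the
  part back to a part of \<open>\<mu>\<close> with the same \<open>j\<close>.\<close>

lemma glaisher_memE:
  assumes m: "m \<ge> 2" and p: "p \<in># glaisher m \<mu>"
  obtains j k l where "p = j * m ^ l" and "\<not> m dvd j" and "j * m ^ k \<in># \<mu>"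
    and "base_digit m (count \<mu> (j * m ^ k)) l \<noteq> 0"
proof -
  have "p > 0"
    using partition_mset_glaisher[OF m, of \<mu>] p by (simp add: partition_mset_def)
  then obtain j l where pj: "p = j * m ^ l" and j: "\<not> m dvd j"
    by (rule nat_power_decompose[OF m])
  have "glaisher_count m \<mu> j l \<noteq> 0"
    using p count_glaisher[OF m j, of \<mu> l] unfolding pj by (simp flip: count_greater_zero_iff)
  then obtain k where "j * m ^ k \<in># \<mu>"
      and "base_digit m (count \<mu> (j * m ^ k)) l * m ^ k \<noteq> 0"
    unfolding glaisher_count_def by (metis (mono_tags, lifting) mem_Collect_eq sum.neutral)
  with pj j show ?thesis by (intro that) auto
qed

lemma regular_glaisher_coprime:
  assumes m: "m \<ge> 2" and "coprime a m" and reg: "regular_partition a \<mu>"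
  shows "regular_partition a (glaisher m \<mu>)"
  unfolding regular_partition_def
proof
  fix p assume "p \<in># glaisher m \<mu>"
  then obtain j k l where p: "p = j * m ^ l" and "\<not> m dvd j" and k: "j * m ^ k \<in># \<mu>"
      and "base_digit m (count \<mu> (j * m ^ k)) l \<noteq> 0"
    by (rule glaisher_memE[OF m])
  \<comment> \<open>A divisor of \<open>j\<close> also divides the part \<open>j * m ^ k\<close> of
    \<open>\<mu>\<close>.\<close>
  have "\<not> a dvd j" using reg k by (auto simp: regular_partition_def)
  thus "\<not> a dvd p" using \<open>coprime a m\<close> by (simp add: p coprime_dvd_mult_left_iff)
qed

lemma regular_glaisher_of_distinct:
  assumes m: "m \<ge> 2" and dist: "distinct_partition m \<mu>"
  shows "regular_partition m (glaisher m \<mu>)"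
  unfolding regular_partition_def
proof
  fix p assume "p \<in># glaisher m \<mu>"
  then obtain j k l where p: "p = j * m ^ l" and j: "\<not> m dvd j"
      and "j * m ^ k \<in># \<mu>" and digit: "base_digit m (count \<mu> (j * m ^ k)) l \<noteq> 0"
    by (rule glaisher_memE[OF m])
  have "l = 0"
  proof (rule ccontr)
    assume "l \<noteq> 0"
    hence "m \<le> m ^ l" using m by (simp add: self_le_power)
    hence "count \<mu> (j * m ^ k) < m ^ l"
      using dist unfolding distinct_partition_def by (meson less_le_trans)
    \<comment> \<open>A number below \<open>m ^ l\<close> has digit 0 at position
      \<open>l\<close>.\<close>
    thus False using digit by (simp add: base_digit_def)
  qed
  thus "\<not> m dvd p" using p j by simp
qed

lemma distinct_glaisher_of_regular:
  assumes m: "m \<ge> 2" and reg: "regular_partition m \<mu>"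
  shows "distinct_partition m (glaisher m \<mu>)"
  unfolding distinct_partition_def
proof
  fix p
  show "count (glaisher m \<mu>) p < m"
  proof (cases "p \<in># glaisher m \<mu>")
    case True
    hence "p > 0"
      using partition_mset_glaisher[OF m, of \<mu>] by (simp add: partition_mset_def)
    then obtain j l where p: "p = j * m ^ l" and j: "\<not> m dvd j"
      by (rule nat_power_decompose[OF m])
    have "k = 0" if "j * m ^ k \<in># \<mu>" for k
    proof (rule ccontr)
      assume "k \<noteq> 0"
      hence "m dvd j * m ^ k" by simp
      thus False using reg that by (simp add: regular_partition_def)
    qed
    hence "{k. j * m ^ k \<in># \<mu>} \<subseteq> {0}" by blast
    \<comment> \<open>Only a bound: the index set is empty if \<open>j\<close> is not a part of
      \<open>\<mu>\<close>.\<close>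
    hence "glaisher_count m \<mu> j l
        \<le> (\<Sum>k\<in>{0}. base_digit m (count \<mu> (j * m ^ k)) l * m ^ k)"
      unfolding glaisher_count_def by (intro sum_mono2) auto
    also have "\<dots> < m" using m by (simp add: base_digit_def)
    finally have "glaisher_count m \<mu> j l < m" .
    thus ?thesis using count_glaisher[OF m j] p by simp
  next
    case False
    thus ?thesis using m by (simp add: not_in_iff)
  qed
qed

theorem theorem6:
  fixes s t :: nat and \<mu> :: "nat multiset"
  assumes "s \<ge> 2" and "t \<ge> 2" and "coprime s t"
    and "partition_mset \<mu>"
    and "regular_partition s \<mu>" and "distinct_partition t \<mu>"
  shows "regular_partition t (glaisher s (glaisher t \<mu>)) \<and>
         distinct_partition s (glaisher s (glaisher t \<mu>))"
proof -
  have "regular_partition t (glaisher t \<mu>)"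
    using assms(2,6) by (rule regular_glaisher_of_distinct)
  moreover have "regular_partition s (glaisher t \<mu>)"
    using assms(2,3,5) by (rule regular_glaisher_coprime)
  moreover have "coprime t s" using assms(3) by (simp add: coprime_commute)
  ultimately show ?thesis
    using regular_glaisher_coprime distinct_glaisher_of_regular assms(1) by blast
qed

end
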